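(* Let $f(x),g(x)\in\mathbb{Z}[x]$ be polynomials of positive degree having no common complex root, and let $d=\gcd(L(f),L(g))$. Then $d\,B(f,g)\mid R(f,g)$.
   Context: $L(h)$ denotes the leading coefficient of $h\in\mathbb{Z}[x]$. There are unique $p,q\in\mathbb{Q}[x]$ with $pf+qg=1$, $\deg p<\deg g$, $\deg q<\deg f$; $B(f,g)$ is the least common multiple of the denominators (in lowest terms) of all coefficients of these $p$ and $q$. $R(f,g)=|\mathrm{Res}(f,g)|$, the absolute value of the resultant of $f$ and $g$. *)

theory Defs
  imports
    "HOL-Computational_Algebra.Computational_Algebra"
    "HOL-Computational_Algebra.Field_as_Ring"
    "Subresultants.Resultant_Prelim"
begin

definition bezout_cofactors :: "int poly \<Rightarrow> int poly \<Rightarrow> rat poly \<times> rat poly" where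
  "bezout_cofactors f g =
     (THE (p, q). p * of_int_poly f + q * of_int_poly g = 1
                \<and> degree p < degree g \<and> degree q < degree f)"

text \<open>The second component of \<^const>\<open>quotient_of\<close> is the positive denominator in lowest terms.\<close>

definition denom :: "rat \<Rightarrow> int" where
  "denom r = snd (quotient_of r)"

text \<open>Coefficients beyond the degree are zero and have denominator 1, so it suffices to
  range over the coefficient lists.\<close>

definition B :: "int poly \<Rightarrow> int poly \<Rightarrow> int" where
  "B f g = (case bezout_cofactors f g of
     (p, q) \<Rightarrow> Lcm (denom ` (set (coeffs p) \<union> set (coeffs q))))"

definition R :: "int poly \<Rightarrow> int poly \<Rightarrow> int" where
  "R f g = \<bar>resultant f g\<bar>"

text \<open>The description in \<^const>\<open>bezout_cofactors\<close> is proper:\<close>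

lemma coprime_of_no_common_complex_root:
  assumes "\<not> (\<exists>z :: complex. poly (of_int_poly f) z = 0 \<and> poly (of_int_poly g) z = 0)" "degree f > 0"
  shows "coprime (of_int_poly f :: rat poly) (of_int_poly g)"
proof (rule ccontr)
  let ?F = "of_int_poly f :: rat poly" and ?G = "of_int_poly g :: rat poly"
  let ?h = "gcd ?F ?G"
  assume nc: "\<not> coprime ?F ?G"
  have F0: "?F \<noteq> 0" using assms(2) by auto
  hence h0: "?h \<noteq> 0" by simp
  have "\<not> is_unit ?h" using nc by (simp only: is_unit_gcd not_False_eq_True)
  hence deg: "degree ?h > 0" by (simp only: is_unit_iff_degree[OF h0] neq0_conv)
  let ?c = "map_poly (of_rat :: rat \<Rightarrow> complex)"
  have "degree (?c ?h) = degree ?h" by simp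
  hence "\<not> constant (poly (?c ?h))" using deg by (simp add: constant_degree)
  then obtain z where z: "poly (?c ?h) z = 0" using fundamental_theorem_of_algebra by blast
  have map_poly_of_rat_mult: "?c (u * v) = ?c u * ?c v" for u v :: "rat poly"
    by (intro poly_eqI) (simp add: coeff_map_poly coeff_mult of_rat_sum of_rat_mult)
  have c: "?c (of_int_poly u) = of_int_poly u" for u :: "int poly"
    by (intro poly_eqI) (simp add: coeff_map_poly)
  have d: "poly (of_int_poly u) z = 0" if dv: "?h dvd of_int_poly u" for u :: "int poly"
  proof -
    from dv obtain k where "of_int_poly u = ?h * k" by (elim dvdE)
    hence "of_int_poly u = ?c ?h * ?c k"
      using c[of u] by (simp add: map_poly_of_rat_mult)
    thus ?thesis using z by simp
  qed
  have "poly (of_int_poly f) z = 0" "poly (of_int_poly g) z = 0" by (rule d, rule gcd_dvd1, rule d, rule gcd_dvd2)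
  thus False using assms(1) by blast
qed

lemma bezout_cofactors_ex1:
  assumes "\<not> (\<exists>z :: complex. poly (of_int_poly f) z = 0 \<and> poly (of_int_poly g) z = 0)" "degree f > 0" "degree g > 0"
  shows "\<exists>!(p, q). (p :: rat poly) * of_int_poly f + q * of_int_poly g = 1
           \<and> degree p < degree g \<and> degree q < degree f"
proof -
  let ?F = "of_int_poly f :: rat poly" and ?G = "of_int_poly g :: rat poly"
  have cop: "coprime ?F ?G" using coprime_of_no_common_complex_root assms by blast
  have dF: "degree ?F = degree f" and dG: "degree ?G = degree g" by simp_all
  have F0: "?F \<noteq> 0" and G0: "?G \<noteq> 0" using assms by auto
  obtain a b where ab: "a * ?F + b * ?G = 1"
    using cop bezout_coefficients_fst_snd[of ?F ?G] by (metis coprime_imp_gcd_eq_1)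
  define p where "p = a mod ?G"
  define q where "q = b + (a div ?G) * ?F"
  have "p * ?F + q * ?G = (a div ?G * ?G + a mod ?G) * ?F + b * ?G"
    unfolding p_def q_def by (simp only: algebra_simps)
  hence pq: "p * ?F + q * ?G = 1" by (simp only: div_mult_mod_eq ab)
  have dp: "degree p < degree g"
    unfolding p_def using degree_mod_less'[OF G0, of a] assms(3) dG
    by (cases "a mod ?G = 0") auto
  have dq: "degree q < degree f"
  proof (cases "q = 0")
    case False
    have "q * ?G = 1 - p * ?F" using pq by (simp add: algebra_simps)
    hence "degree q + degree ?G = degree (1 - p * ?F)"
      using degree_mult_eq[OF False G0] by simp
    also have "\<dots> \<le> max (degree (1 :: rat poly)) (degree (p * ?F))" by (rule degree_diff_le_max)
    also have "\<dots> \<le> degree p + degree ?F" using degree_mult_le[of p ?F] by simp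
    finally show ?thesis using dp dF dG by linarith
  qed (use assms in simp)
  have uniq: "p' = p \<and> q' = q"
    if e: "p' * ?F + q' * ?G = 1" and d: "degree p' < degree g" for p' q'
  proof -
    have eq: "(p' - p) * ?F = (q - q') * ?G" using e pq by (simp add: algebra_simps)
    hence "?G dvd (p' - p) * ?F" by simp
    hence "?G dvd p' - p" using cop by (simp add: coprime_commute coprime_dvd_mult_left_iff)
    moreover have "degree (p' - p) < degree ?G" using d dp dG by (simp add: degree_diff_less)
    ultimately have "p' - p = 0" using dvd_imp_degree_le leD by blast
    thus ?thesis using eq G0 by simp
  qed
  show ?thesis
  proof (rule ex1I[of _ "(p, q)"], unfold case_prod_conv, intro conjI)
    fix r :: "rat poly \<times> rat poly"
    assume "case r of (p, q) \<Rightarrow> p * ?F + q * ?G = 1 \<and> degree p < degree g \<and> degree q < degree f"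
    moreover obtain p' q' where r: "r = (p', q')" by (rule prod.exhaust)
    ultimately have *: "p' * ?F + q' * ?G = 1 \<and> degree p' < degree g \<and> degree q' < degree f"
      by (simp only: case_prod_conv)
    show "r = (p, q)"
      unfolding r prod.inject by (rule uniq[OF conjunct1[OF *] conjunct1[OF conjunct2[OF *]]])
  qed (fact pq dp dq)+
qed

end

theory Submission
  imports Defs
begin

text \<open>
  The cofactors of the last column of the Sylvester matrix are the coefficients of integer
  polynomials \<open>P\<close>, \<open>Q\<close> with \<open>P f + Q g = Res(f, g)\<close>. The matrices whose determinants give these
  cofactors still contain entries of the first column, which are \<open>0\<close>, \<open>L(f)\<close> or \<open>L(g)\<close>; hence
  \<open>d\<close> divides \<open>P\<close>, \<open>Q\<close> and so \<open>Res(f, g) = d r\<close>. Then \<open>p\<close> and \<open>q\<close> are \<open>P / (d r)\<close> and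
  \<open>Q / (d r)\<close>, with coefficients in \<open>\<int> / r\<close>.
\<close>

lemma dvd_det_if_dvd_column:
  fixes A :: "'a :: comm_ring_1 mat"
  assumes A: "A \<in> carrier_mat n n" and j: "j < n"
    and dvd: "\<And>i. i < n \<Longrightarrow> c dvd A $$ (i, j)"
  shows "c dvd det A"
  unfolding laplace_expansion_column[OF A j] by (intro dvd_sum dvd_mult2 dvd) simp

text \<open>Deleting a column with \<open>j > 0\<close> leaves the first column in place, merely
  without its entry in row \<open>i\<close>, so the minor can still be expanded along it.\<close>

lemma dvd_cofactor_if_dvd_first_column:
  fixes A :: "'a :: comm_ring_1 mat"
  assumes A: "A \<in> carrier_mat n n" and i: "i < n" and j: "0 < j" "j < n"
    and dvd: "\<And>i. i < n \<Longrightarrow> c dvd A $$ (i, 0)"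
  shows "c dvd cofactor A i j"
proof -
  have "c dvd det (mat_delete A i j)"
  proof (rule dvd_det_if_dvd_column)
    show "mat_delete A i j \<in> carrier_mat (n - 1) (n - 1)"
      using A by (rule mat_delete_carrier)
    show "0 < n - 1" using j by simp
    fix k assume "k < n - 1"
    with A i j show "c dvd mat_delete A i j $$ (k, 0)"
      by (auto simp: mat_delete_def intro!: dvd)
  qed
  thus ?thesis unfolding cofactor_def by simp
qed

lemma sylvester_mat_column_0:
  assumes "degree g > 0" "i < degree f + degree g"
  shows "sylvester_mat f g $$ (i, 0) =
           (if i = 0 then lead_coeff f else if i = degree g then lead_coeff g else 0)"
  using assms by (subst sylvester_index_mat) auto

text \<open>The rows list the coefficients of x^(n-1-i) f and x^(m+n-1-i) g from degree m+n-1
  downwards, so a combination of rows is a polynomial combination of f and g.\<close>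

lemma sylvester_index_mat_coeff:
  fixes f g :: "'a :: comm_semiring_1 poly"
  defines "m \<equiv> degree f" and "n \<equiv> degree g"
  assumes i: "i < m + n" and j: "j < m + n"
  shows "sylvester_mat f g $$ (i, j) =
    (if i < n then coeff (monom 1 (n - 1 - i) * f) (m + n - 1 - j)
     else coeff (monom 1 (m + n - 1 - i) * g) (m + n - 1 - j))"
proof -
  \<comment> \<open>In \<open>sylvester_index_mat2\<close> both the monomial degree and the
    coefficient index are one larger; they can be lowered together.\<close>
  have shift: "coeff (monom 1 (Suc a) * h) (Suc b) = coeff (monom 1 a * h) b"
    for a b and h :: "'a poly"
    by (simp add: coeff_monom_mult)
  define b where "b = m + n - 1 - j"
  have b: "m + n - j = Suc b" using j by (simp add: b_def)
  show ?thesis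
  proof (cases "i < n")
    case True
    define a where "a = n - 1 - i"
    have "n - i = Suc a" using True by (simp add: a_def)
    with True b show ?thesis
      using sylvester_index_mat2[of i f g j] i j shift[of a f b]
      by (simp add: m_def n_def a_def b_def)
  next
    case False
    define a where "a = m + n - 1 - i"
    have "m + n - i = Suc a" using i by (simp add: a_def)
    with False b show ?thesis
      using sylvester_index_mat2[of i f g j] i j shift[of a g b]
      by (simp add: m_def n_def a_def b_def)
  qed
qed

text \<open>The degree bounds serve to match \<open>P\<close> and \<open>Q\<close>, after scaling,
  with the unique Bezout cofactors. Divisibility is stated for every common divisor
  \<open>c\<close>, since a general commutative ring has no gcd.\<close>

lemma resultant_combination:
  fixes f g :: "'a :: comm_ring_1 poly"
  assumes f: "degree f > 0" and g: "degree g > 0"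
  obtains P Q where "P * f + Q * g = [:resultant f g:]"
    "degree P < degree g" "degree Q < degree f"
    "\<And>c k. c dvd lead_coeff f \<Longrightarrow> c dvd lead_coeff g \<Longrightarrow> c dvd coeff P k"
    "\<And>c k. c dvd lead_coeff f \<Longrightarrow> c dvd lead_coeff g \<Longrightarrow> c dvd coeff Q k"
proof -
  define m n where "m = degree f" and "n = degree g"
  define A where "A = sylvester_mat f g"
  define C where "C i = cofactor A i (m + n - 1)" for i
  \<comment> \<open>Row \<open>i\<close> gets weight \<open>C i\<close>; the exponents here and in
    \<open>Q\<close> are the shifts of f and g in that row.\<close>
  define P where "P = (\<Sum>i<n. monom (C i) (n - 1 - i))"
  define Q where "Q = (\<Sum>i=n..<m+n. monom (C i) (m + n - 1 - i))"
  have m: "m > 0" and n: "n > 0" using f g by (simp_all add: m_def n_def)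
  have A: "A \<in> carrier_mat (m + n) (m + n)"
    unfolding A_def m_def n_def by (rule sylvester_carrier_mat)
  have dvd_C: "c dvd C i" if "c dvd lead_coeff f" "c dvd lead_coeff g" "i < m + n" for c i
    unfolding C_def
  proof (rule dvd_cofactor_if_dvd_first_column[OF A])
    show "c dvd A $$ (k, 0)" if "k < m + n" for k
      using that \<open>c dvd lead_coeff f\<close> \<open>c dvd lead_coeff g\<close> g
      by (simp add: A_def m_def n_def sylvester_mat_column_0)
  qed (use m n that in auto)
  have dP: "degree P < n"
    unfolding P_def using n by (intro degree_sum_less) (auto intro: le_less_trans[OF degree_monom_le])
  have dQ: "degree Q < m"
    unfolding Q_def using m by (intro degree_sum_less) (auto intro: le_less_trans[OF degree_monom_le])
  have high: "coeff (P * f + Q * g) k = 0" if "k \<ge> m + n" for k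
  proof -
    have "degree (P * f) \<le> degree P + m" "degree (Q * g) \<le> degree Q + n"
      unfolding m_def n_def by (rule degree_mult_le)+
    thus ?thesis using dP dQ that by (simp add: coeff_eq_0)
  qed
  \<comment> \<open>Column \<open>j\<close> belongs to degree m+n-1-j. The \<open>C i\<close> form
    the last row of \<open>adj_mat A\<close>, and \<open>adj_mat A * A\<close> is
    \<open>det A\<close> times the identity, so only the constant term survives.\<close>
  have low: "coeff (P * f + Q * g) (m + n - 1 - j) = (if j = m + n - 1 then resultant f g else 0)"
    if j: "j < m + n" for j
  proof -
    have monom: "monom (C i) k = Polynomial.smult (C i) (monom 1 k)" for i k by (simp add: smult_monom)
    have "coeff (P * f + Q * g) (m + n - 1 - j) =
        (\<Sum>i<n. C i * coeff (monom 1 (n - 1 - i) * f) (m + n - 1 - j)) +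
        (\<Sum>i=n..<m+n. C i * coeff (monom 1 (m + n - 1 - i) * g) (m + n - 1 - j))"
      unfolding P_def Q_def
      by (simp only: monom sum_distrib_right coeff_add coeff_sum mult_smult_left coeff_smult)
    also have "\<dots> = (\<Sum>i<n. C i * A $$ (i, j)) + (\<Sum>i=n..<m+n. C i * A $$ (i, j))"
      using j by (intro arg_cong2[where f = "(+)"] sum.cong)
        (auto simp: A_def m_def n_def sylvester_index_mat_coeff)
    also have "\<dots> = (\<Sum>i<m+n. C i * A $$ (i, j))"
      by (subst sum.union_disjoint[symmetric]) (auto intro!: sum.cong)
    also have "\<dots> = (adj_mat A * A) $$ (m + n - 1, j)"
      using A j m by (simp add: C_def adj_mat_def scalar_prod_def atLeast0LessThan)
    also have "\<dots> = (if j = m + n - 1 then resultant f g else 0)"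
      unfolding adj_mat(3)[OF A] using j m by (auto simp: resultant_def A_def)
    finally show ?thesis .
  qed
  have "P * f + Q * g = [:resultant f g:]"
  proof (rule poly_eqI)
    fix k
    show "coeff (P * f + Q * g) k = coeff [:resultant f g:] k"
    proof (cases "k < m + n")
      case True
      then show ?thesis using low[of "m + n - 1 - k"]
        by (cases k) auto
    next
      case False
      then show ?thesis using high[of k] m by (cases k) auto
    qed
  qed
  moreover have "c dvd coeff P k" "c dvd coeff Q k"
    if "c dvd lead_coeff f" "c dvd lead_coeff g" for c k
    unfolding P_def Q_def coeff_sum using that by (auto intro!: dvd_sum dvd_C)
  ultimately show ?thesis using dP dQ unfolding m_def n_def by (intro that)
qed

text \<open>Cross-multiplying with the reduced fraction u/v gives a v = u b, and v is coprime to u.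
  The sign of \<open>b\<close> is left free because the resultant may be negative.\<close>

lemma denom_divide_dvd:
  assumes "b \<noteq> 0"
  shows "denom (of_int a / of_int b) dvd b"
proof -
  obtain u v where uv: "quotient_of (of_int a / of_int b) = (u, v)" by fastforce
  have v: "v > 0" and cop: "coprime u v"
    using quotient_of_denom_pos[OF uv] quotient_of_coprime[OF uv] by auto
  have "(of_int a / of_int b :: rat) = of_int u / of_int v" using quotient_of_div[OF uv] .
  hence "of_int a * of_int v = (of_int u * of_int b :: rat)" using assms v by (simp add: field_simps)
  hence "a * v = u * b" by (simp only: of_int_mult[symmetric] of_int_eq_iff)
  hence "v dvd u * b" by (metis dvd_triv_right)
  hence "v dvd b" using cop by (simp add: coprime_commute coprime_dvd_mult_right_iff)
  thus ?thesis by (simp add: denom_def uv)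
qed

theorem theorem5p1:
  fixes f g :: "int poly" and d :: int
  assumes "degree f > 0" and "degree g > 0"
    and "\<not> (\<exists>z :: complex. poly (of_int_poly f) z = 0 \<and> poly (of_int_poly g) z = 0)"
    and "d = gcd (lead_coeff f) (lead_coeff g)"
  shows "d * B f g dvd R f g"
\<comment> \<open>Everything divides 0, so it need not be shown that coprimality makes the resultant
  nonzero.\<close>
proof (cases "resultant f g = 0")
  case True
  thus ?thesis by (simp add: R_def)
next
  case False
  obtain P Q where PQ: "P * f + Q * g = [:resultant f g:]"
    and deg: "degree P < degree g" "degree Q < degree f"
    and dvd: "\<And>k. d dvd coeff P k" "\<And>k. d dvd coeff Q k"
    using resultant_combination[OF assms(1,2)] assms(4) by (metis gcd_dvd1 gcd_dvd2)
  have d0: "d \<noteq> 0" using assms(1,4) by auto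
  have "[:d:] dvd P" "[:d:] dvd Q" by (simp_all add: const_poly_dvd_iff dvd)
  then obtain P' Q' where P': "P = Polynomial.smult d P'" and Q': "Q = Polynomial.smult d Q'"
    by (auto elim!: dvdE)
  \<comment> \<open>Cancelling \<open>d\<close> below shows that the whole polynomial is the
    constant \<open>r\<close>.\<close>
  define r where "r = coeff (P' * f + Q' * g) 0"
  have eq: "Polynomial.smult d (P' * f + Q' * g) = [:resultant f g:]"
    using PQ by (simp add: P' Q' smult_add_right)
  have res: "resultant f g = d * r"
    using arg_cong[OF eq, of "\<lambda>h. coeff h 0"] by (simp add: r_def)
  have r0: "r \<noteq> 0" using False res by auto
  have "Polynomial.smult d (P' * f + Q' * g) = Polynomial.smult d [:r:]" by (simp add: eq res)
  hence r: "P' * f + Q' * g = [:r:]" using d0 by (simp only: smult_cancel simp_thms)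
  define c :: rat where "c = inverse (of_int r)"
  define p q where "p = Polynomial.smult c (of_int_poly P')" and "q = Polynomial.smult c (of_int_poly Q')"
  have "p * of_int_poly f + q * of_int_poly g = Polynomial.smult c (of_int_poly (P' * f + Q' * g))"
    by (simp add: p_def q_def smult_add_right of_int_poly_hom.hom_add of_int_poly_hom.hom_mult)
  also have "\<dots> = 1" using r0 by (simp add: r c_def pCons_one)
  finally have "p * of_int_poly f + q * of_int_poly g = 1" .
  moreover have "degree p < degree g" "degree q < degree f"
    using deg d0 r0 by (simp_all add: p_def q_def c_def P' Q')
  \<comment> \<open>Uniqueness turns the explicit pair into the one chosen by
    \<open>THE\<close>.\<close>
  ultimately have "bezout_cofactors f g = (p, q)"
    unfolding bezout_cofactors_def
    using the1_equality[OF bezout_cofactors_ex1[OF assms(3,1,2)], of "(p, q)"] by simp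
  moreover have "denom (coeff p k) dvd r" "denom (coeff q k) dvd r" for k
    using denom_divide_dvd[OF r0] by (simp_all add: p_def q_def c_def divide_inverse mult.commute[of "inverse _"])
  ultimately have "B f g dvd r"
    by (auto simp: B_def coeffs_def intro!: Lcm_least)
  thus ?thesis by (simp add: R_def res)
qed

end
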